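(* Let $m,n>-1/2$ and $0\le|\beta_i|<\alpha_i$, $i=1,2$. Let $X\sim\mathrm{VG}(m,\alpha_1,\beta_1,0)$ and $Y\sim\mathrm{VG}(n,\alpha_2,\beta_2,0)$ be independent, and let $Z=X/Y$. Then, for real $k$ with $\max\{-1,-2m-1\}<k<\min\{1,2n+1\}$, \begin{align*} \mathbb{E}[|Z|^k]&=\frac{\alpha_2^k(1-\beta_1^2/\alpha_1^2)^{m+1/2}(1-\beta_2^2/\alpha_2^2)^{n+1/2}}{\alpha_1^k\cos(k\pi/2)\Gamma(m+1/2)\Gamma(n+1/2)}\,\Gamma\Big(m+\frac{k+1}{2}\Big)\Gamma\Big(n+\frac{1-k}{2}\Big)\\ &\quad\times{}_2F_1\bigg(\frac{k+1}{2},m+\frac{k+1}{2};\frac12;\frac{\beta_1^2}{\alpha_1^2}\bigg)\,{}_2F_1\bigg(\frac{1-k}{2},n+\frac{1-k}{2};\frac12;\frac{\beta_2^2}{\alpha_2^2}\bigg). \end{align*}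
   Context: For $m>-1/2$ and $0\le|\beta|<\alpha$, a random variable $X$ has the variance-gamma distribution $\mathrm{VG}(m,\alpha,\beta,0)$ if it has probability density function $$f_X(x)=\frac{\gamma^{2m+1}}{\sqrt{\pi}(2\alpha)^m\Gamma(m+1/2)}\,\mathrm{e}^{\beta x}|x|^mK_m(\alpha|x|),\quad x\in\mathbb{R},\qquad \gamma^2=\alpha^2-\beta^2,\ \gamma>0,$$ where $K_m(x)=\int_0^\infty \mathrm{e}^{-x\cosh t}\cosh(mt)\,\mathrm{d}t$, $x>0$, is the modified Bessel function of the second kind. ${}_2F_1(a,b;c;x)=\sum_{j=0}^\infty\frac{(a)_j(b)_j}{(c)_j}\frac{x^j}{j!}$ for $|x|<1$, with $(u)_j=u(u+1)\cdots(u+j-1)$. *)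

theory Defs
  imports "HOL-Probability.Probability"
begin

(* Meaningful for x > 0; for x <= 0 the integrand is not integrable and the value is junk. *)
definition bessel_K :: "real \<Rightarrow> real \<Rightarrow> real" where
  "bessel_K m x = (LBINT t:{0..}. exp (- x * cosh t) * cosh (m * t))"

(* Meaningful for \<bar>x\<bar> < 1 and c not a non-positive integer. *)
definition hyp2F1 :: "real \<Rightarrow> real \<Rightarrow> real \<Rightarrow> real \<Rightarrow> real" where
  "hyp2F1 a b c x =
     (\<Sum>j. pochhammer a j * pochhammer b j / pochhammer c j * (x ^ j / fact j))"

(* Density of VG(m, \<alpha>, \<beta>, 0), for m > -1/2 and \<bar>\<beta>\<bar> < \<alpha>. The value at the
   single point x = 0, where the formula may be singular, is irrelevant. *)
definition vg_density :: "real \<Rightarrow> real \<Rightarrow> real \<Rightarrow> real \<Rightarrow> real" where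
  "vg_density m \<alpha> \<beta> x =
     (let \<gamma> = sqrt (\<alpha>\<^sup>2 - \<beta>\<^sup>2) in
      \<gamma> powr (2 * m + 1) / (sqrt pi * (2 * \<alpha>) powr m * Gamma (m + 1 / 2)) *
      exp (\<beta> * x) * \<bar>x\<bar> powr m * bessel_K m (\<alpha> * \<bar>x\<bar>))"

definition vg_distributed :: "'a measure \<Rightarrow> ('a \<Rightarrow> real) \<Rightarrow> real \<Rightarrow> real \<Rightarrow> real \<Rightarrow> bool" where
  "vg_distributed M X m \<alpha> \<beta> \<longleftrightarrow> distributed M lborel X (\<lambda>x. ennreal (vg_density m \<alpha> \<beta> x))"

end

theory Submission
  imports Defs "HOL-Real_Asymp.Real_Asymp"
begin

text \<open>By independence the expectation factors as \<open>E \<bar>X\<bar>\<^sup>k \<cdot> E \<bar>Y\<bar>\<^sup>-\<^sup>k\<close>. An absolute moment of a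
variance-gamma variable is obtained by folding the density onto the half-line, which turns
\<open>exp (\<beta> x)\<close> into \<open>2 cosh (\<beta> x)\<close>, expanding \<open>cosh\<close> into its power series, and integrating termwise
against the Mellin transform
\<open>\<integral> x\<^sup>s\<^sup>-\<^sup>1 K\<^sub>m(x) dx = 2\<^sup>s\<^sup>-\<^sup>2 \<Gamma>((s - m)/2) \<Gamma>((s + m)/2)\<close>; all integrands are nonnegative, so Tonelli
suffices throughout. The Mellin transform reduces to a Beta integral: the substitution
\<open>p = exp t / (2 cosh t)\<close> gives \<open>1 - p = exp (- t) / (2 cosh t)\<close> and \<open>dp = 2 p (1 - p) dt\<close>.
In the product of the two moments the factors \<open>\<Gamma>((1 + k)/2) \<Gamma>((1 - k)/2)\<close> collapse to
\<open>\<pi> / cos (k \<pi> / 2)\<close> by the reflection formula.\<close>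

section \<open>Folding integrals onto the half-line, and the hyperbolic form of the Beta
  integral\<close>

text \<open>The two closed half-lines overlap only in the null set {0}, and x -> -x carries one to
  the other. Stated for \<open>ennreal\<close> values, so it applies before any integrability is
  known.\<close>

lemma nn_integral_lborel_reflect:
  fixes f :: "real \<Rightarrow> ennreal"
  assumes [measurable]: "f \<in> borel_measurable borel"
  shows "(\<integral>\<^sup>+x. f x \<partial>lborel) = (\<integral>\<^sup>+x. indicator {0..} x * (f x + f (- x)) \<partial>lborel)"
proof -
  have refl: "(\<integral>\<^sup>+x. indicator {0..} x * f (- x) \<partial>lborel) = (\<integral>\<^sup>+x. indicator {..0} x * f x \<partial>lborel)"
    by (subst nn_integral_real_affine[where c = "-1" and t = 0])
       (auto intro!: nn_integral_cong simp: indicator_def)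
  have "(\<integral>\<^sup>+x. f x \<partial>lborel) = (\<integral>\<^sup>+x. indicator {0..} x * f x + indicator {..0} x * f x \<partial>lborel)"
  proof (rule nn_integral_cong_AE)
    show "AE x in lborel. f x = indicator {0..} x * f x + indicator {..0} x * f x"
      using AE_lborel_singleton[of 0] by eventually_elim (auto simp: indicator_def)
  qed
  also have "\<dots> = (\<integral>\<^sup>+x. indicator {0..} x * f x \<partial>lborel) + (\<integral>\<^sup>+x. indicator {..0} x * f x \<partial>lborel)"
    by (rule nn_integral_add) auto
  also have "\<dots> = (\<integral>\<^sup>+x. indicator {0..} x * f x \<partial>lborel) + (\<integral>\<^sup>+x. indicator {0..} x * f (- x) \<partial>lborel)"
    by (simp only: refl)
  also have "\<dots> = (\<integral>\<^sup>+x. indicator {0..} x * f x + indicator {0..} x * f (- x) \<partial>lborel)"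
    by (rule nn_integral_add[symmetric]) auto
  finally show ?thesis
    by (simp add: distrib_left)
qed

text \<open>With p = \<open>g t\<close> the integrand is p^a (1 - p)^b. The Jacobian 2 p (1 - p)
  raises the Beta exponents a - 1 and b - 1 by one, and its factor 2 accounts for the halved Beta
  value.\<close>

lemma has_integral_exp_div_cosh_powr:
  fixes a b :: real
  assumes a: "a > 0" and b: "b > 0"
  shows "((\<lambda>t. exp ((a - b) * t) / (2 * cosh t) powr (a + b)) has_integral Beta a b / 2) UNIV"
proof -
  define g where "g t = exp t / (2 * cosh t)" for t :: real
  define g' where "g' t = 2 / (2 * cosh t)\<^sup>2" for t :: real
  define f where "f p = p powr (a - 1) * (1 - p) powr (b - 1)" for p :: real
  have D: "2 * cosh t = exp t + exp (- t)" for t :: real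
    by (simp add: cosh_def)
  have Dpos: "exp t + exp (- t) > 0" for t :: real
    by (simp add: add_pos_pos)
  have one_minus_g: "1 - g t = exp (- t) / (2 * cosh t)" for t
    unfolding g_def D using Dpos[of t] by (simp add: field_simps)
  have der: "(g has_field_derivative g' t) (at t)" for t
    unfolding g_def g'_def D using Dpos[of t]
    by (auto intro!: derivative_eq_intros simp: field_simps power2_eq_square exp_minus)
  have inj: "inj g"
  proof (rule injI)
    fix x y assume eq: "g x = g y"
    \<comment> \<open>The odds p / (1 - p) determine t, which gives injectivity; solving the same
      relation for t yields the preimage used for surjectivity onto (0, 1).\<close>
    have "exp (2 * t) = g t / (1 - g t)" for t
    proof -
      have "g t / (1 - g t) = exp t / exp (- t)"
        unfolding one_minus_g unfolding g_def using cosh_real_pos[of t] by simp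
      then show ?thesis by (simp add: exp_diff[symmetric])
    qed
    from this[of x] this[of y] eq have "exp (2 * x) = exp (2 * y)" by simp
    then show "x = y" by simp
  qed
  have img: "range g = {0<..<1}"
  proof (intro set_eqI iffI)
    fix p assume "p \<in> range g"
    then obtain t where t: "p = g t" by auto
    have "0 < g t" unfolding g_def by (simp add: cosh_real_pos)
    moreover have "0 < 1 - g t" unfolding one_minus_g by (simp add: cosh_real_pos)
    ultimately show "p \<in> {0<..<1}" using t by simp
  next
    fix p :: real assume p: "p \<in> {0<..<1}"
    define t where "t = ln (p / (1 - p)) / 2"
    have e: "exp t * exp t = p / (1 - p)"
      using p by (simp add: t_def flip: exp_add)
    have "g t = (exp t * exp t) / (exp t * exp t + 1)"
      unfolding g_def D by (simp add: exp_minus field_simps)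
    also have "\<dots> = p"
      unfolding e using p by (simp add: field_simps)
    finally show "p \<in> range g" by (metis rangeI)
  qed
  have F: "(f has_integral Beta a b) {0<..<1}"
    using has_integral_Beta_real[OF a b] unfolding f_def
    by (simp add: has_integral_Icc_iff_Ioo)
  \<comment> \<open>The change-of-variables theorem concerns absolute integrability, which the
    nonnegativity of \<open>f\<close> supplies.\<close>
  have "f absolutely_integrable_on {0<..<1}"
    using F by (intro nonnegative_absolutely_integrable_1) (auto simp: f_def integrable_on_def)
  with F have "f absolutely_integrable_on range g \<and> integral (range g) f = Beta a b"
    unfolding img by (simp add: integral_unique)
  then have "(\<lambda>t. \<bar>g' t\<bar> * f (g t)) absolutely_integrable_on UNIV \<and>
      integral UNIV (\<lambda>t. \<bar>g' t\<bar> * f (g t)) = Beta a b"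
    using has_absolute_integral_change_of_variables_1'[of UNIV g g' f "Beta a b"] der inj by simp
  then have "((\<lambda>t. \<bar>g' t\<bar> * f (g t)) has_integral Beta a b) UNIV"
    by (metis has_integral_integral set_lebesgue_integral_eq_integral(1))
  then have "((\<lambda>t. \<bar>g' t\<bar> * f (g t) / 2) has_integral Beta a b / 2) UNIV"
    by (rule has_integral_divide)
  also have "(\<lambda>t. \<bar>g' t\<bar> * f (g t) / 2) = (\<lambda>t. exp ((a - b) * t) / (2 * cosh t) powr (a + b))"
  proof
    fix t :: real
    define d where "d = 2 * cosh t"
    have d: "d > 0" by (simp add: d_def cosh_real_pos)
    have "f (g t) = (exp t powr (a - 1) * exp (- t) powr (b - 1)) / (d powr (a - 1) * d powr (b - 1))"
      unfolding f_def one_minus_g unfolding g_def d_def[symmetric] using d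
      by (simp add: powr_divide)
    also have "exp t powr (a - 1) * exp (- t) powr (b - 1) = exp ((a - b) * t)"
      by (simp add: powr_def algebra_simps flip: exp_add)
    also have "d powr (a - 1) * d powr (b - 1) = d powr (a + b) / d\<^sup>2"
      using d by (simp add: powr_add powr_diff power2_eq_square)
    finally show "\<bar>g' t\<bar> * f (g t) / 2 = exp ((a - b) * t) / (2 * cosh t) powr (a + b)"
      using d unfolding g'_def d_def[symmetric] by simp
  qed
  finally show ?thesis .
qed

text \<open>This is the preceding integral at a = (s + m)/2, b = (s - m)/2, so that a - b = m and a
  + b = s; folding turns exp(m t) into 2 cosh(m t). The hypothesis on \<open>s\<close> says exactly
  that a and b are positive.\<close>

lemma nn_integral_cosh_div_cosh_powr:
  fixes m s :: real
  assumes s: "\<bar>m\<bar> < s"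
  shows "(\<integral>\<^sup>+t. indicator {0..} t * ennreal (cosh (m * t) / cosh t powr s) \<partial>lborel) =
    ennreal (2 powr (s - 2) * Beta ((s + m) / 2) ((s - m) / 2))"
proof -
  define f :: "real \<Rightarrow> real" where "f t = exp (m * t) / (2 * cosh t) powr s" for t
  have cosh_meas [measurable]: "(cosh :: real \<Rightarrow> real) \<in> borel_measurable borel"
    by (intro borel_measurable_continuous_onI continuous_intros)
  have [measurable]: "f \<in> borel_measurable borel"
    unfolding f_def by measurable
  let ?B = "Beta ((s + m) / 2) ((s - m) / 2)"
  have ab: "(s + m) / 2 > 0" "(s - m) / 2 > 0"
    using s by auto
  then have B: "?B > 0"
    using Gamma_real_pos[OF ab(1)] Gamma_real_pos[OF ab(2)] Gamma_real_pos[OF add_pos_pos[OF ab]]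
    unfolding Beta_def by (intro divide_pos_pos mult_pos_pos)
  have sums: "(s + m) / 2 - (s - m) / 2 = m" "(s + m) / 2 + (s - m) / 2 = s"
    by (simp_all add: field_simps)
  have "(f has_integral ?B / 2) UNIV"
    using has_integral_exp_div_cosh_powr[OF ab] unfolding sums f_def[abs_def] .
  moreover have "f t \<ge> 0" for t
    by (simp add: f_def)
  ultimately have "ennreal (?B / 2) = (\<integral>\<^sup>+t. ennreal (f t) \<partial>lborel)"
    by (intro nn_integral_has_integral_lborel[symmetric]) auto
  also have "\<dots> = (\<integral>\<^sup>+t. indicator {0..} t * (ennreal (f t) + ennreal (f (- t))) \<partial>lborel)"
    by (rule nn_integral_lborel_reflect) simp
  also have "\<dots> = (\<integral>\<^sup>+t. ennreal (2 powr (1 - s)) * (indicator {0..} t * ennreal (cosh (m * t) / cosh t powr s)) \<partial>lborel)"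
  proof (rule nn_integral_cong)
    fix t :: real
    have "exp (m * t) + exp (- (m * t)) = 2 * cosh (m * t)"
      by (simp add: cosh_def)
    then have "f t + f (- t) = 2 * cosh (m * t) / (2 * cosh t) powr s"
      by (simp add: f_def flip: add_divide_distrib)
    also have "\<dots> = 2 powr (1 - s) * (cosh (m * t) / cosh t powr s)"
      by (simp add: powr_mult cosh_real_nonneg powr_diff)
    finally have "ennreal (f t) + ennreal (f (- t)) =
        ennreal (2 powr (1 - s)) * ennreal (cosh (m * t) / cosh t powr s)"
      by (simp add: f_def cosh_real_nonneg flip: ennreal_plus ennreal_mult')
    then show "indicator {0..} t * (ennreal (f t) + ennreal (f (- t))) =
        ennreal (2 powr (1 - s)) * (indicator {0..} t * ennreal (cosh (m * t) / cosh t powr s))"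
      by (simp add: mult_ac)
  qed
  also have "\<dots> = ennreal (2 powr (1 - s)) * (\<integral>\<^sup>+t. indicator {0..} t * ennreal (cosh (m * t) / cosh t powr s) \<partial>lborel)"
    by (rule nn_integral_cmult) measurable
  \<comment> \<open>Multiplying by the reciprocal of \<open>2 powr (1 - s)\<close> isolates the
    integral without first knowing that it is finite.\<close>
  finally have "ennreal (2 powr (s - 1)) * ennreal (?B / 2) =
      ennreal (2 powr (s - 1)) * ennreal (2 powr (1 - s)) *
      (\<integral>\<^sup>+t. indicator {0..} t * ennreal (cosh (m * t) / cosh t powr s) \<partial>lborel)"
    by (simp add: mult.assoc)
  also have "ennreal (2 powr (s - 1)) * ennreal (2 powr (1 - s)) = 1"
    by (simp add: ennreal_mult'[symmetric] powr_add[symmetric])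
  also have "ennreal (2 powr (s - 1)) * ennreal (?B / 2) = ennreal (2 powr (s - 2) * ?B)"
    using B by (simp add: ennreal_mult'[symmetric] powr_diff)
  finally show ?thesis by simp
qed

section \<open>The Mellin transform of the Bessel function K\<close>

text \<open>Euler's integral for Gamma after the rescaling t = c x.\<close>

lemma nn_integral_powr_exp:
  fixes s c :: real
  assumes s: "s > 0" and c: "c > 0"
  shows "(\<integral>\<^sup>+x. indicator {0..} x * ennreal (x powr (s - 1) * exp (- (c * x))) \<partial>lborel) =
    ennreal (Gamma s / c powr s)"
proof -
  let ?I = "\<integral>\<^sup>+x. indicator {0..} x * ennreal (x powr (s - 1) * exp (- (c * x))) \<partial>lborel"
  have "ennreal (Gamma s) = (\<integral>\<^sup>+t. ennreal (indicator {0..} t * t powr (s - 1) / exp t) \<partial>lborel)"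
    by (rule Gamma_conv_nn_integral_real[OF s])
  also have "\<dots> = ennreal c * (\<integral>\<^sup>+x. ennreal (indicator {0..} (c * x) * (c * x) powr (s - 1) / exp (c * x)) \<partial>lborel)"
    using c by (subst nn_integral_real_affine[where c = c and t = 0]) auto
  also have "\<dots> = ennreal c * (\<integral>\<^sup>+x. ennreal (c powr (s - 1)) * (indicator {0..} x * ennreal (x powr (s - 1) * exp (- (c * x)))) \<partial>lborel)"
    using c
    by (intro arg_cong2[where f = "(*)"] refl nn_integral_cong)
       (auto simp: indicator_def powr_mult exp_minus field_simps zero_le_mult_iff simp flip: ennreal_mult')
  also have "\<dots> = ennreal c * (ennreal (c powr (s - 1)) * ?I)"
    by (subst nn_integral_cmult) measurable
  also have "\<dots> = ennreal (c powr s) * ?I"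
    using c by (simp add: mult.assoc[symmetric] ennreal_mult'[symmetric] powr_diff)
  finally have "ennreal (inverse (c powr s)) * ennreal (Gamma s) =
      ennreal (inverse (c powr s)) * ennreal (c powr s) * ?I"
    by (simp add: mult.assoc)
  also have "ennreal (inverse (c powr s)) * ennreal (c powr s) = 1"
    using c by (simp add: ennreal_mult'[symmetric])
  also have "ennreal (inverse (c powr s)) * ennreal (Gamma s) = ennreal (Gamma s / c powr s)"
    using c by (subst ennreal_mult'[symmetric]) (auto simp: divide_inverse mult.commute)
  finally show ?thesis by simp
qed

lemma borel_measurable_cosh [measurable]: "(cosh :: real \<Rightarrow> real) \<in> borel_measurable borel"
  by (intro borel_measurable_continuous_onI continuous_intros)

lemma borel_measurable_bessel_K [measurable]: "bessel_K m \<in> borel_measurable borel"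
  unfolding bessel_K_def[abs_def] set_lebesgue_integral_def by measurable

text \<open>The integrand is nonnegative, and where the integral diverges both sides default to 0.
  This links \<open>bessel_K\<close> to an extended-valued integral to which Tonelli
  applies.\<close>

lemma bessel_K_eq_enn2real:
  "bessel_K m x =
    enn2real (\<integral>\<^sup>+t. indicator {0..} t * ennreal (exp (- x * cosh t) * cosh (m * t)) \<partial>lborel)"
proof -
  have "bessel_K m x =
      enn2real (\<integral>\<^sup>+t. ennreal (indicator {0..} t *\<^sub>R (exp (- x * cosh t) * cosh (m * t))) \<partial>lborel)"
    unfolding bessel_K_def set_lebesgue_integral_def
    by (rule integral_eq_nn_integral) (auto simp: cosh_real_nonneg)
  also have "(\<integral>\<^sup>+t. ennreal (indicator {0..} t *\<^sub>R (exp (- x * cosh t) * cosh (m * t))) \<partial>lborel) =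
      (\<integral>\<^sup>+t. indicator {0..} t * ennreal (exp (- x * cosh t) * cosh (m * t)) \<partial>lborel)"
    by (intro nn_integral_cong) (auto simp: indicator_def)
  finally show ?thesis .
qed

lemma bessel_K_nonneg: "bessel_K m x \<ge> 0"
  by (simp add: bessel_K_eq_enn2real)

text \<open>After swapping the integrals, the x-integral is a Gamma integral with rate \<alpha> cosh
  t. The remaining t-integral is a Beta value, whose denominator \<open>Gamma s\<close> cancels the
  Gamma factor just produced.\<close>

lemma nn_integral_powr_bessel_K:
  fixes m s \<alpha> :: real
  assumes s: "\<bar>m\<bar> < s" and \<alpha>: "\<alpha> > 0"
  shows "(\<integral>\<^sup>+x. indicator {0..} x * ennreal (x powr (s - 1) * bessel_K m (\<alpha> * x)) \<partial>lborel) =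
    ennreal (2 powr (s - 2) * Gamma ((s + m) / 2) * Gamma ((s - m) / 2) / \<alpha> powr s)"
proof -
  \<comment> \<open>The extended-valued counterpart of \<open>bessel_K m (\<alpha> * x)\<close>,
    used until convergence is established.\<close>
  define K where
    "K x = (\<integral>\<^sup>+t. indicator {0..} t * ennreal (exp (- (\<alpha> * x) * cosh t) * cosh (m * t)) \<partial>lborel)" for x
  have K_meas [measurable]: "K \<in> borel_measurable borel"
    unfolding K_def by measurable
  let ?I = "\<integral>\<^sup>+x. indicator {0..} x * ennreal (x powr (s - 1)) * K x \<partial>lborel"
  have Gs: "Gamma s > 0" using s by (intro Gamma_real_pos) auto
  have "?I = (\<integral>\<^sup>+x. (\<integral>\<^sup>+t. indicator {0..} x * ennreal (x powr (s - 1)) *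
      (indicator {0..} t * ennreal (exp (- (\<alpha> * x) * cosh t) * cosh (m * t))) \<partial>lborel) \<partial>lborel)"
    unfolding K_def by (intro nn_integral_cong nn_integral_cmult[symmetric]) measurable
  also have "\<dots> = (\<integral>\<^sup>+t. (\<integral>\<^sup>+x. indicator {0..} x * ennreal (x powr (s - 1)) *
      (indicator {0..} t * ennreal (exp (- (\<alpha> * x) * cosh t) * cosh (m * t))) \<partial>lborel) \<partial>lborel)"
    by (rule lborel_pair.Fubini') measurable
  also have "\<dots> = (\<integral>\<^sup>+t. ennreal (Gamma s / \<alpha> powr s) *
      (indicator {0..} t * ennreal (cosh (m * t) / cosh t powr s)) \<partial>lborel)"
  proof (rule nn_integral_cong)
    fix t :: real
    have "(\<integral>\<^sup>+x. indicator {0..} x * ennreal (x powr (s - 1)) *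
        (indicator {0..} t * ennreal (exp (- (\<alpha> * x) * cosh t) * cosh (m * t))) \<partial>lborel) =
      (\<integral>\<^sup>+x. (indicator {0..} t * ennreal (cosh (m * t))) *
        (indicator {0..} x * ennreal (x powr (s - 1) * exp (- (\<alpha> * cosh t * x)))) \<partial>lborel)"
      by (intro nn_integral_cong) (simp add: ennreal_mult' cosh_real_nonneg mult_ac)
    also have "\<dots> = (indicator {0..} t * ennreal (cosh (m * t))) *
        ennreal (Gamma s / (\<alpha> * cosh t) powr s)"
      using s \<alpha> cosh_real_pos[of t]
      by (subst nn_integral_cmult) (auto simp: nn_integral_powr_exp)
    also have "\<dots> = ennreal (Gamma s / \<alpha> powr s) *
      (indicator {0..} t * ennreal (cosh (m * t) / cosh t powr s))"
      using Gs \<alpha> cosh_real_pos[of t] cosh_real_nonneg[of "m * t"]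
      by (auto simp: indicator_def powr_mult mult_ac simp flip: ennreal_mult')
    finally show "(\<integral>\<^sup>+x. indicator {0..} x * ennreal (x powr (s - 1)) *
        (indicator {0..} t * ennreal (exp (- (\<alpha> * x) * cosh t) * cosh (m * t))) \<partial>lborel) = \<dots>" .
  qed
  also have "\<dots> = ennreal (Gamma s / \<alpha> powr s) *
      ennreal (2 powr (s - 2) * Beta ((s + m) / 2) ((s - m) / 2))"
    by (subst nn_integral_cmult) (auto simp: nn_integral_cosh_div_cosh_powr[OF s])
  also have "\<dots> = ennreal (Gamma s / \<alpha> powr s * (2 powr (s - 2) * Beta ((s + m) / 2) ((s - m) / 2)))"
    using Gs by (intro ennreal_mult'[symmetric]) auto
  also have "Gamma s / \<alpha> powr s * (2 powr (s - 2) * Beta ((s + m) / 2) ((s - m) / 2)) =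
      2 powr (s - 2) * Gamma ((s + m) / 2) * Gamma ((s - m) / 2) / \<alpha> powr s"
    using Gs by (simp add: Beta_def add_divide_distrib diff_divide_distrib)
  finally have I: "?I = ennreal (2 powr (s - 2) * Gamma ((s + m) / 2) * Gamma ((s - m) / 2) / \<alpha> powr s)" .
  \<comment> \<open>Finiteness of the double integral is what makes the real-valued Bessel integral genuine almost everywhere.\<close>
  have "AE x in lborel. indicator {0..} x * ennreal (x powr (s - 1)) * K x \<noteq> \<infinity>"
    by (rule nn_integral_PInf_AE) (auto simp: I)
  then have "AE x in lborel. indicator {0..} x * ennreal (x powr (s - 1) * bessel_K m (\<alpha> * x)) =
      indicator {0..} x * ennreal (x powr (s - 1)) * K x"
  proof eventually_elim
    case (elim x)
    show ?case
    proof (cases "x > 0")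
      case True
      then have "K x \<noteq> \<infinity>"
        using elim by (auto simp: ennreal_mult_eq_top_iff)
      then have "ennreal (bessel_K m (\<alpha> * x)) = K x"
        unfolding bessel_K_eq_enn2real K_def[symmetric] by (simp add: less_top)
      then show ?thesis
        by (simp add: ennreal_mult bessel_K_nonneg mult.assoc)
    \<comment> \<open>At 0 both sides vanish because \<open>0 powr (s - 1)\<close> is 0 by
      convention; for negative x the indicator vanishes.\<close>
    qed (cases "x = 0"; simp)
  qed
  then show ?thesis
    unfolding I[symmetric] by (rule nn_integral_cong_AE)
qed

section \<open>Convergence and sign of the hypergeometric series, and the cosh series\<close>

text \<open>Ratio test: successive terms have ratio tending to x < 1, hence eventually below the
  midpoint (1 + x)/2.\<close>

lemma summable_hyp2F1:
  fixes a b c x :: real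
  assumes a: "a > 0" and b: "b > 0" and c: "c > 0" and x: "0 \<le> x" "x < 1"
  shows "summable (\<lambda>j. pochhammer a j * pochhammer b j / pochhammer c j * (x ^ j / fact j))"
proof -
  define f where "f j = pochhammer a j * pochhammer b j / pochhammer c j * (x ^ j / fact j)" for j
  have "((\<lambda>j. (a + real j) * (b + real j) / ((c + real j) * (1 + real j)) * x) \<longlongrightarrow> x) at_top"
    by real_asymp
  then have "\<forall>\<^sub>F j in sequentially.
      (a + real j) * (b + real j) / ((c + real j) * (1 + real j)) * x < (1 + x) / 2"
    by (rule order_tendstoD) (use x in auto)
  then obtain N where N: "\<And>j. j \<ge> N \<Longrightarrow>
      (a + real j) * (b + real j) / ((c + real j) * (1 + real j)) * x < (1 + x) / 2"
    by (auto simp: eventually_sequentially)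
  have f_nonneg: "f j \<ge> 0" for j
    using a b c x by (auto simp: f_def intro!: mult_nonneg_nonneg divide_nonneg_nonneg pochhammer_nonneg)
  have f_Suc: "f (Suc j) = (a + real j) * (b + real j) / ((c + real j) * (1 + real j)) * x * f j" for j
    using c pochhammer_pos[OF c, of j] unfolding f_def
    by (simp add: pochhammer_Suc field_simps)
  have "summable f"
  proof (rule summable_ratio_test)
    show "(1 + x) / 2 < 1" using x by simp
    fix j assume "N \<le> j"
    then show "norm (f (Suc j)) \<le> (1 + x) / 2 * norm (f j)"
      using N[of j] f_nonneg[of j] f_nonneg[of "Suc j"]
      by (simp only: real_norm_def abs_of_nonneg f_Suc) (intro mult_right_mono, auto)
  qed
  then show ?thesis unfolding f_def .
qed

lemma hyp2F1_nonneg: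
  fixes a b c x :: real
  assumes "a > 0" "b > 0" "c > 0" "0 \<le> x" "x < 1"
  shows "hyp2F1 a b c x \<ge> 0"
  unfolding hyp2F1_def using assms
  by (intro suminf_nonneg summable_hyp2F1)
     (auto intro!: mult_nonneg_nonneg divide_nonneg_nonneg pochhammer_nonneg)

lemma cosh_sums: "(\<lambda>j. y ^ (2 * j) / fact (2 * j)) sums cosh (y :: real)"
proof -
  have "(\<lambda>j. if even (2 * j) then y ^ (2 * j) /\<^sub>R fact (2 * j) else 0) sums cosh y"
    by (subst sums_mono_reindex[of "\<lambda>j. 2 * j" "\<lambda>n. if even n then y ^ n /\<^sub>R fact n else 0"])
       (auto simp: strict_mono_def cosh_converges elim!: evenE)
  then show ?thesis
    by (simp add: divide_inverse mult.commute)
qed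

section \<open>Absolute moments of the variance-gamma distribution\<close>

text \<open>The closed form of E|X|^k, shown to be the moment in
  \<open>vg_distributed_abs_moment\<close>. It is used at k for the numerator and at -k for the
  denominator.\<close>

definition vg_abs_moment :: "real \<Rightarrow> real \<Rightarrow> real \<Rightarrow> real \<Rightarrow> real" where
  "vg_abs_moment m \<alpha> \<beta> k =
     2 powr k * (1 - \<beta>\<^sup>2 / \<alpha>\<^sup>2) powr (m + 1 / 2) / (sqrt pi * \<alpha> powr k * Gamma (m + 1 / 2)) *
     Gamma ((k + 1) / 2) * Gamma (m + (k + 1) / 2) *
     hyp2F1 ((k + 1) / 2) (m + (k + 1) / 2) (1 / 2) (\<beta>\<^sup>2 / \<alpha>\<^sup>2)"

lemma square_ratio_less_one:
  fixes \<alpha> \<beta> :: real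
  assumes "\<bar>\<beta>\<bar> < \<alpha>"
  shows "\<beta>\<^sup>2 / \<alpha>\<^sup>2 < 1"
  using assms power_strict_mono[of "\<bar>\<beta>\<bar>" \<alpha> 2] by (auto simp: divide_less_eq)

text \<open>The bounds on \<open>k\<close> make the Gamma and hypergeometric parameters positive.
  The sign is what allows passing from the \<open>ennreal\<close> moment to a Bochner
  integral.\<close>

lemma vg_abs_moment_nonneg:
  assumes "m > - 1 / 2" "\<bar>\<beta>\<bar> < \<alpha>" "k > - 1" "k > - 2 * m - 1"
  shows "vg_abs_moment m \<alpha> \<beta> k \<ge> 0"
proof -
  have "m + (k + 1) / 2 > 0" "(k + 1) / 2 > 0" "m + 1 / 2 > 0"
    using assms by (auto simp: field_simps)
  then show ?thesis
    unfolding vg_abs_moment_def using square_ratio_less_one[OF assms(2)]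
    by (intro mult_nonneg_nonneg divide_nonneg_nonneg hyp2F1_nonneg Gamma_real_nonneg) auto
qed

text \<open>The j-th term of the cosh series contributes the Mellin transform at s = m + k + 1 + 2j.
  Its Gamma factors are Gamma(a + j) and Gamma(b + j), which produce the Pochhammer symbols of the
  hypergeometric series.\<close>

lemma nn_integral_powr_bessel_K_cosh:
  fixes m k \<alpha> \<beta> :: real
  assumes \<beta>: "\<bar>\<beta>\<bar> < \<alpha>" and k: "k > - 1" "k > - 2 * m - 1"
  defines "a \<equiv> (k + 1) / 2" and "b \<equiv> m + (k + 1) / 2"
  shows "(\<integral>\<^sup>+x. indicator {0..} x * ennreal (x powr (m + k) * bessel_K m (\<alpha> * x) * cosh (\<beta> * x)) \<partial>lborel) =
    ennreal (2 powr (m + k - 1) * Gamma a * Gamma b / \<alpha> powr (m + k + 1) * hyp2F1 a b (1 / 2) (\<beta>\<^sup>2 / \<alpha>\<^sup>2))"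
proof -
  have \<alpha>: "\<alpha> > 0" using \<beta> by auto
  have ab: "a > 0" "b > 0" using k by (auto simp: a_def b_def field_simps)
  define z where "z = \<beta>\<^sup>2 / \<alpha>\<^sup>2"
  have z: "0 \<le> z" "z < 1"
    using square_ratio_less_one[OF \<beta>] by (auto simp: z_def)
  define A where "A = 2 powr (m + k - 1) * Gamma a * Gamma b / \<alpha> powr (m + k + 1)"
  have A: "A \<ge> 0" using ab by (auto simp: A_def)
  define h where "h j = pochhammer a j * pochhammer b j / pochhammer (1 / 2) j * (z ^ j / fact j)" for j
  have h_nonneg: "h j \<ge> 0" for j
    unfolding h_def using ab z
    by (intro mult_nonneg_nonneg divide_nonneg_nonneg pochhammer_nonneg) auto
  have summable_h: "summable h"
    unfolding h_def using ab z by (intro summable_hyp2F1) auto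
  have moment_term: "(\<integral>\<^sup>+x. indicator {0..} x * ennreal (x powr (m + k) * bessel_K m (\<alpha> * x) *
      ((\<beta> * x) ^ (2 * j) / fact (2 * j))) \<partial>lborel) = ennreal (A * h j)" for j
  proof -
    define s where "s = m + k + 1 + 2 * real j"
    have s: "\<bar>m\<bar> < s" using k by (auto simp: s_def)
    have s_args: "(s + m) / 2 = b + real j" "(s - m) / 2 = a + real j"
      by (simp_all add: s_def a_def b_def field_simps)
    have "(\<integral>\<^sup>+x. indicator {0..} x * ennreal (x powr (m + k) * bessel_K m (\<alpha> * x) *
        ((\<beta> * x) ^ (2 * j) / fact (2 * j))) \<partial>lborel) =
      (\<integral>\<^sup>+x. ennreal (\<beta> ^ (2 * j) / fact (2 * j)) *
        (indicator {0..} x * ennreal (x powr (s - 1) * bessel_K m (\<alpha> * x))) \<partial>lborel)"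
    proof (rule nn_integral_cong)
      fix x :: real
      \<comment> \<open>The case x = 0 survives, even for j = 0, because \<open>powr\<close> with
        base 0 is always 0.\<close>
      have shift: "x powr (s - 1) = x powr (m + k) * x ^ (2 * j)" if "x \<ge> 0"
      proof (cases "x = 0")
        case False
        with that have "x ^ (2 * j) = x powr (2 * real j)"
          by (simp add: powr_realpow[symmetric])
        then show ?thesis
          by (simp add: s_def powr_add[symmetric] algebra_simps)
      qed simp
      have eq: "x powr (m + k) * bessel_K m (\<alpha> * x) * ((\<beta> * x) ^ (2 * j) / fact (2 * j)) =
          \<beta> ^ (2 * j) / fact (2 * j) * (x powr (s - 1) * bessel_K m (\<alpha> * x))" if "x \<ge> 0"
        using that by (simp add: shift power_mult_distrib)
      have "ennreal (x powr (m + k) * bessel_K m (\<alpha> * x) * ((\<beta> * x) ^ (2 * j) / fact (2 * j))) =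
          ennreal (\<beta> ^ (2 * j) / fact (2 * j)) * ennreal (x powr (s - 1) * bessel_K m (\<alpha> * x))"
        if "x \<ge> 0"
        unfolding eq[OF that] by (rule ennreal_mult') simp
      then show "indicator {0..} x * ennreal (x powr (m + k) * bessel_K m (\<alpha> * x) *
          ((\<beta> * x) ^ (2 * j) / fact (2 * j))) =
        ennreal (\<beta> ^ (2 * j) / fact (2 * j)) *
          (indicator {0..} x * ennreal (x powr (s - 1) * bessel_K m (\<alpha> * x)))"
        by (cases "x \<ge> 0") simp_all
    qed
    also have "\<dots> = ennreal (\<beta> ^ (2 * j) / fact (2 * j)) *
        ennreal (2 powr (s - 2) * Gamma ((s + m) / 2) * Gamma ((s - m) / 2) / \<alpha> powr s)"
      by (subst nn_integral_cmult) (auto simp: nn_integral_powr_bessel_K[OF s \<alpha>])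
    also have "\<dots> = ennreal (\<beta> ^ (2 * j) / fact (2 * j) *
        (2 powr (s - 2) * Gamma ((s + m) / 2) * Gamma ((s - m) / 2) / \<alpha> powr s))"
      by (intro ennreal_mult'[symmetric]) simp
    also have "\<beta> ^ (2 * j) / fact (2 * j) *
        (2 powr (s - 2) * Gamma ((s + m) / 2) * Gamma ((s - m) / 2) / \<alpha> powr s) = A * h j"
    proof -
      have Gamma_shift: "Gamma (u + real j) = pochhammer u j * Gamma u" if "u > 0" for u :: real
      proof -
        have "u \<notin> \<int>\<^sub>\<le>\<^sub>0" using that by (auto elim: nonpos_Ints_cases)
        moreover have "Gamma u \<noteq> 0" using Gamma_real_pos[OF that] by linarith
        ultimately show ?thesis by (simp add: pochhammer_Gamma)
      qed
      have powr_shift: "u powr (v + 2 * real j) = u powr v * u ^ (2 * j)" if "u > 0" for u v :: real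
        using that powr_realpow[of u "2 * j"] by (simp add: powr_add)
      have two: "2 powr (s - 2) = 2 powr (m + k - 1) * 2 ^ (2 * j)"
        using powr_shift[of 2 "m + k - 1"] by (simp add: s_def algebra_simps)
      have al: "\<alpha> powr s = \<alpha> powr (m + k + 1) * \<alpha> ^ (2 * j)"
        unfolding s_def by (rule powr_shift[OF \<alpha>])
      \<comment> \<open>Here t stands for 2^(2j): it comes from the Mellin constant and cancels
        against \<open>fact_double\<close>, (2j)! = 2^(2j) (1/2)_j j!. The factor c = (1/2)_j left
        over is the source of the lower parameter 1/2.\<close>
      have cancel: "p / (t * c * f) * (e * t * (v * B) * (u * G) / (d * q)) =
          e * G * B / d * (u * v / c * (p / q / f))" if "t > 0"
        for p t c f e v B u G d q :: real
        using that by (simp add: mult_ac)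
      have z_pow: "z ^ j = \<beta> ^ (2 * j) / \<alpha> ^ (2 * j)"
        by (simp only: z_def power_divide power_mult)
      show ?thesis
        unfolding s_args two al Gamma_shift[OF ab(1)] Gamma_shift[OF ab(2)] A_def h_def fact_double z_pow
        by (rule cancel) simp
    qed
    finally show ?thesis .
  qed
  have "(\<integral>\<^sup>+x. indicator {0..} x * ennreal (x powr (m + k) * bessel_K m (\<alpha> * x) * cosh (\<beta> * x)) \<partial>lborel) =
    (\<integral>\<^sup>+x. (\<Sum>j. indicator {0..} x * ennreal (x powr (m + k) * bessel_K m (\<alpha> * x) *
      ((\<beta> * x) ^ (2 * j) / fact (2 * j)))) \<partial>lborel)"
  proof (rule nn_integral_cong)
    fix x :: real
    have "(\<lambda>j. x powr (m + k) * bessel_K m (\<alpha> * x) * ((\<beta> * x) ^ (2 * j) / fact (2 * j))) sums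
        (x powr (m + k) * bessel_K m (\<alpha> * x) * cosh (\<beta> * x))"
      by (intro sums_mult cosh_sums)
    then have "(\<Sum>j. ennreal (x powr (m + k) * bessel_K m (\<alpha> * x) * ((\<beta> * x) ^ (2 * j) / fact (2 * j)))) =
        ennreal (x powr (m + k) * bessel_K m (\<alpha> * x) * cosh (\<beta> * x))"
      by (intro suminf_ennreal_eq) (auto simp: bessel_K_nonneg)
    then show "indicator {0..} x * ennreal (x powr (m + k) * bessel_K m (\<alpha> * x) * cosh (\<beta> * x)) =
      (\<Sum>j. indicator {0..} x * ennreal (x powr (m + k) * bessel_K m (\<alpha> * x) *
        ((\<beta> * x) ^ (2 * j) / fact (2 * j))))"
      by (simp only: ennreal_suminf_cmult)
  qed
  also have "\<dots> = (\<Sum>j. ennreal (A * h j))"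
    by (subst nn_integral_suminf) (simp_all only: moment_term, measurable)
  also have "\<dots> = ennreal (\<Sum>j. A * h j)"
    using A h_nonneg summable_h by (intro suminf_ennreal2) auto
  also have "(\<Sum>j. A * h j) = A * hyp2F1 a b (1 / 2) z"
    unfolding hyp2F1_def using suminf_mult[OF summable_h, of A] by (simp only: h_def[abs_def])
  finally show ?thesis
    unfolding A_def z_def .
qed

text \<open>The weight |x|^k merges with the factor |x|^m of the density, and folding leaves twice
  the normalising constant times the preceding integral.\<close>

lemma nn_integral_vg_density:
  fixes m k \<alpha> \<beta> :: real
  assumes m: "m > - 1 / 2" and \<beta>: "\<bar>\<beta>\<bar> < \<alpha>" and k: "k > - 1" "k > - 2 * m - 1"
  shows "(\<integral>\<^sup>+x. ennreal (vg_density m \<alpha> \<beta> x) * ennreal (\<bar>x\<bar> powr k) \<partial>lborel) =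
    ennreal (vg_abs_moment m \<alpha> \<beta> k)"
proof -
  have \<alpha>: "\<alpha> > 0" using \<beta> by auto
  define C where "C = sqrt (\<alpha>\<^sup>2 - \<beta>\<^sup>2) powr (2 * m + 1) / (sqrt pi * (2 * \<alpha>) powr m * Gamma (m + 1 / 2))"
  have Gm: "Gamma (m + 1 / 2) > 0" using m by (intro Gamma_real_pos) auto
  then have C: "C \<ge> 0" by (auto simp: C_def)
  define f where "f x = C * exp (\<beta> * x) * \<bar>x\<bar> powr (m + k) * bessel_K m (\<alpha> * \<bar>x\<bar>)" for x
  have [measurable]: "f \<in> borel_measurable borel"
    unfolding f_def by measurable
  have f_nonneg: "f x \<ge> 0" for x
    using C by (simp add: f_def bessel_K_nonneg)
  let ?a = "(k + 1) / 2" and ?b = "m + (k + 1) / 2"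
  let ?H = "hyp2F1 ?a ?b (1 / 2) (\<beta>\<^sup>2 / \<alpha>\<^sup>2)"
  have "(\<integral>\<^sup>+x. ennreal (vg_density m \<alpha> \<beta> x) * ennreal (\<bar>x\<bar> powr k) \<partial>lborel) =
      (\<integral>\<^sup>+x. ennreal (f x) \<partial>lborel)"
  proof (rule nn_integral_cong)
    fix x
    have "vg_density m \<alpha> \<beta> x * \<bar>x\<bar> powr k = f x"
      unfolding vg_density_def Let_def C_def[symmetric] f_def by (simp add: powr_add)
    then show "ennreal (vg_density m \<alpha> \<beta> x) * ennreal (\<bar>x\<bar> powr k) = ennreal (f x)"
      by (simp flip: ennreal_mult'')
  qed
  also have "\<dots> = (\<integral>\<^sup>+x. indicator {0..} x * (ennreal (f x) + ennreal (f (- x))) \<partial>lborel)"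
    by (rule nn_integral_lborel_reflect) simp
  also have "\<dots> = (\<integral>\<^sup>+x. ennreal (2 * C) * (indicator {0..} x *
      ennreal (x powr (m + k) * bessel_K m (\<alpha> * x) * cosh (\<beta> * x))) \<partial>lborel)"
  proof (rule nn_integral_cong)
    fix x :: real
    have "f x + f (- x) = 2 * C * (x powr (m + k) * bessel_K m (\<alpha> * x) * cosh (\<beta> * x))" if "x \<ge> 0"
      using that by (simp add: f_def cosh_def algebra_simps)
    then show "indicator {0..} x * (ennreal (f x) + ennreal (f (- x))) =
        ennreal (2 * C) * (indicator {0..} x *
          ennreal (x powr (m + k) * bessel_K m (\<alpha> * x) * cosh (\<beta> * x)))"
      using C f_nonneg by (auto simp: indicator_def simp flip: ennreal_mult' ennreal_plus)
  qed
  also have "\<dots> = ennreal (2 * C) *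
      ennreal (2 powr (m + k - 1) * Gamma ?a * Gamma ?b / \<alpha> powr (m + k + 1) * ?H)"
    by (subst nn_integral_cmult) (auto simp: nn_integral_powr_bessel_K_cosh[OF \<beta> k])
  also have "\<dots> = ennreal (2 * C *
      (2 powr (m + k - 1) * Gamma ?a * Gamma ?b / \<alpha> powr (m + k + 1) * ?H))"
    using C by (intro ennreal_mult'[symmetric]) simp
  also have "2 * C * (2 powr (m + k - 1) * Gamma ?a * Gamma ?b / \<alpha> powr (m + k + 1) * ?H) =
      vg_abs_moment m \<alpha> \<beta> k"
  proof -
    \<comment> \<open>Writing \<gamma> as \<alpha> times the square root of r separates the scale
      from the skewness ratio.\<close>
    define r where "r = 1 - \<beta>\<^sup>2 / \<alpha>\<^sup>2"
    have r: "r > 0" using square_ratio_less_one[OF \<beta>] by (simp add: r_def)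
    have "\<alpha>\<^sup>2 - \<beta>\<^sup>2 = \<alpha>\<^sup>2 * r"
      using \<alpha> by (simp add: r_def field_simps)
    then have "sqrt (\<alpha>\<^sup>2 - \<beta>\<^sup>2) = \<alpha> * r powr (1 / 2)"
      using \<alpha> r by (simp add: real_sqrt_mult powr_half_sqrt)
    then have "sqrt (\<alpha>\<^sup>2 - \<beta>\<^sup>2) powr (2 * m + 1) = \<alpha> powr (2 * m + 1) * r powr (m + 1 / 2)"
      using \<alpha> by (simp add: powr_mult powr_powr algebra_simps)
    \<comment> \<open>The first factor cancels against \<open>(2 * \<alpha>) powr m\<close> in the
      density, the second against the Mellin transform; only \<open>\<alpha> powr k\<close> in the
      denominator remains.\<close>
    also have "\<alpha> powr (2 * m + 1) = \<alpha> powr m * \<alpha> powr (m + k + 1) / \<alpha> powr k"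
      using \<alpha> by (simp flip: powr_add powr_diff)
    finally have gam: "sqrt (\<alpha>\<^sup>2 - \<beta>\<^sup>2) powr (2 * m + 1) =
        \<alpha> powr m * \<alpha> powr (m + k + 1) / \<alpha> powr k * r powr (m + 1 / 2)" .
    have two: "2 powr (m + k - 1) = 2 powr m * 2 powr k / (2 :: real)"
      by (simp add: powr_add powr_diff)
    define G where "G = Gamma (m + 1 / 2)"
    show ?thesis
      unfolding vg_abs_moment_def C_def gam two r_def[symmetric] G_def[symmetric]
      using \<alpha> Gm[folded G_def] by (simp add: powr_mult mult_ac)
  qed
  finally show ?thesis .
qed

text \<open>A finite nonnegative integral gives integrability and the value of the expectation at
  once.\<close>

lemma vg_distributed_abs_moment:
  assumes "m > - 1 / 2" "\<bar>\<beta>\<bar> < \<alpha>" "k > - 1" "k > - 2 * m - 1"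
    and X: "vg_distributed M X m \<alpha> \<beta>"
  shows "integrable M (\<lambda>\<omega>. \<bar>X \<omega>\<bar> powr k)"
    and "(LINT \<omega>|M. \<bar>X \<omega>\<bar> powr k) = vg_abs_moment m \<alpha> \<beta> k"
proof -
  have D: "distributed M lborel X (\<lambda>x. ennreal (vg_density m \<alpha> \<beta> x))"
    using X by (simp add: vg_distributed_def)
  have [measurable]: "X \<in> borel_measurable M"
    using distributed_measurable[OF D] by simp
  have "(\<integral>\<^sup>+\<omega>. ennreal (\<bar>X \<omega>\<bar> powr k) \<partial>M) = ennreal (vg_abs_moment m \<alpha> \<beta> k)"
    using distributed_nn_integral[OF D, of "\<lambda>x. ennreal (\<bar>x\<bar> powr k)"]
      nn_integral_vg_density[OF assms(1-4)] by simp
  then have "has_bochner_integral M (\<lambda>\<omega>. \<bar>X \<omega>\<bar> powr k) (vg_abs_moment m \<alpha> \<beta> k)"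
    by (intro has_bochner_integral_nn_integral vg_abs_moment_nonneg assms) auto
  then show "integrable M (\<lambda>\<omega>. \<bar>X \<omega>\<bar> powr k)"
    and "(LINT \<omega>|M. \<bar>X \<omega>\<bar> powr k) = vg_abs_moment m \<alpha> \<beta> k"
    by (auto simp: has_bochner_integral_iff)
qed

section \<open>The reflection formula and the moments of the ratio\<close>

text \<open>Euler's reflection at u = (k + 1)/2, transferred from the complex Gamma function; the
  shift by pi/2 turns sine into cosine. At odd integers k both sides are 0, since Gamma at its poles
  and division by zero have value 0.\<close>

lemma Gamma_reflection_half:
  fixes k :: real
  shows "Gamma ((k + 1) / 2) * Gamma ((1 - k) / 2) = pi / cos (k * pi / 2)"
proof -
  define u where "u = (k + 1) / 2"
  have "complex_of_real (Gamma u * Gamma (1 - u)) = Gamma (of_real u) * Gamma (1 - of_real u)"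
    using Gamma_complex_of_real[of u] Gamma_complex_of_real[of "1 - u"] by simp
  also have "\<dots> = complex_of_real (pi / sin (pi * u))"
    unfolding Gamma_reflection_complex by (simp flip: sin_of_real)
  finally have "Gamma u * Gamma (1 - u) = pi / sin (pi * u)"
    by (simp only: of_real_eq_iff)
  moreover have "1 - u = (1 - k) / 2" "pi * u = k * pi / 2 + pi / 2"
    by (simp_all add: u_def field_simps)
  ultimately show ?thesis
    by (simp add: sin_add flip: u_def)
qed

theorem proposition2p12:
  fixes M :: "'a measure" and X Y Z :: "'a \<Rightarrow> real"
    and m n \<alpha>\<^sub>1 \<alpha>\<^sub>2 \<beta>\<^sub>1 \<beta>\<^sub>2 k :: real
  assumes "prob_space M"
    and "m > - 1 / 2" and "n > - 1 / 2"
    and "\<bar>\<beta>\<^sub>1\<bar> < \<alpha>\<^sub>1" and "\<bar>\<beta>\<^sub>2\<bar> < \<alpha>\<^sub>2"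
    and "vg_distributed M X m \<alpha>\<^sub>1 \<beta>\<^sub>1"
    and "vg_distributed M Y n \<alpha>\<^sub>2 \<beta>\<^sub>2"
    and "prob_space.indep_var M borel X borel Y"
    and "Z = (\<lambda>\<omega>. X \<omega> / Y \<omega>)"
    and "max (- 1) (- 2 * m - 1) < k" and "k < min 1 (2 * n + 1)"
  shows "integrable M (\<lambda>\<omega>. \<bar>Z \<omega>\<bar> powr k) \<and>
    prob_space.expectation M (\<lambda>\<omega>. \<bar>Z \<omega>\<bar> powr k) =
      (\<alpha>\<^sub>2 powr k * (1 - \<beta>\<^sub>1\<^sup>2 / \<alpha>\<^sub>1\<^sup>2) powr (m + 1 / 2) * (1 - \<beta>\<^sub>2\<^sup>2 / \<alpha>\<^sub>2\<^sup>2) powr (n + 1 / 2)) /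
      (\<alpha>\<^sub>1 powr k * cos (k * pi / 2) * Gamma (m + 1 / 2) * Gamma (n + 1 / 2)) *
      Gamma (m + (k + 1) / 2) * Gamma (n + (1 - k) / 2) *
      hyp2F1 ((k + 1) / 2) (m + (k + 1) / 2) (1 / 2) (\<beta>\<^sub>1\<^sup>2 / \<alpha>\<^sub>1\<^sup>2) *
      hyp2F1 ((1 - k) / 2) (n + (1 - k) / 2) (1 / 2) (\<beta>\<^sub>2\<^sup>2 / \<alpha>\<^sub>2\<^sup>2)"
proof -
  interpret prob_space M by fact
  \<comment> \<open>The range of \<open>k\<close> is exactly the moment condition for X at k
    together with that for Y at -k.\<close>
  have k: "k > - 1" "k > - 2 * m - 1" "- k > - 1" "- k > - 2 * n - 1"
    using assms(10,11) by auto
  note X = vg_distributed_abs_moment[OF assms(2,4) k(1,2) assms(6)]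
  note Y = vg_distributed_abs_moment[OF assms(3,5) k(3,4) assms(7)]
  \<comment> \<open>This holds pointwise, even where Y vanishes: division by zero and
    \<open>powr\<close> with base 0 make both sides 0, so no null set has to be removed.\<close>
  have Z: "\<bar>Z \<omega>\<bar> powr k = \<bar>X \<omega>\<bar> powr k * \<bar>Y \<omega>\<bar> powr (- k)" for \<omega>
    unfolding assms(9) abs_divide by (simp add: powr_divide powr_minus_divide)
  have "indep_var borel ((\<lambda>x. \<bar>x\<bar> powr k) \<circ> X) borel ((\<lambda>x. \<bar>x\<bar> powr (- k)) \<circ> Y)"
    by (rule indep_var_compose[OF assms(8)]) measurable
  then have indep: "indep_var borel (\<lambda>\<omega>. \<bar>X \<omega>\<bar> powr k) borel (\<lambda>\<omega>. \<bar>Y \<omega>\<bar> powr (- k))"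
    by (simp add: o_def)
  have "integrable M (\<lambda>\<omega>. \<bar>Z \<omega>\<bar> powr k)"
    unfolding Z by (rule indep_var_integrable[OF indep X(1) Y(1)])
  moreover have "expectation (\<lambda>\<omega>. \<bar>Z \<omega>\<bar> powr k) =
      vg_abs_moment m \<alpha>\<^sub>1 \<beta>\<^sub>1 k * vg_abs_moment n \<alpha>\<^sub>2 \<beta>\<^sub>2 (- k)"
    unfolding Z indep_var_lebesgue_integral[OF indep X(1) Y(1)] X(2) Y(2) ..
  moreover have "vg_abs_moment m \<alpha>\<^sub>1 \<beta>\<^sub>1 k * vg_abs_moment n \<alpha>\<^sub>2 \<beta>\<^sub>2 (- k) =
      (\<alpha>\<^sub>2 powr k * (1 - \<beta>\<^sub>1\<^sup>2 / \<alpha>\<^sub>1\<^sup>2) powr (m + 1 / 2) * (1 - \<beta>\<^sub>2\<^sup>2 / \<alpha>\<^sub>2\<^sup>2) powr (n + 1 / 2)) /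
      (\<alpha>\<^sub>1 powr k * cos (k * pi / 2) * Gamma (m + 1 / 2) * Gamma (n + 1 / 2)) *
      Gamma (m + (k + 1) / 2) * Gamma (n + (1 - k) / 2) *
      hyp2F1 ((k + 1) / 2) (m + (k + 1) / 2) (1 / 2) (\<beta>\<^sub>1\<^sup>2 / \<alpha>\<^sub>1\<^sup>2) *
      hyp2F1 ((1 - k) / 2) (n + (1 - k) / 2) (1 / 2) (\<beta>\<^sub>2\<^sup>2 / \<alpha>\<^sub>2\<^sup>2)"
    (is "?lhs = ?A / (\<alpha>\<^sub>1 powr k * ?c * ?G1 * ?G2) * ?G3 * ?G4 * ?H1 * ?H2")
  proof -
    have neg: "- k + 1 = 1 - k" by simp
    \<comment> \<open>Grouped so that the powers of 2 cancel and the two factors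
      \<open>sqrt pi\<close> form the pi that the reflection formula removes. The double negation
      lets \<open>powr_minus\<close> match the reciprocal of
      \<open>\<alpha>\<^sub>2 powr (- k)\<close>.\<close>
    have "?lhs = (2 powr k * 2 powr (- k)) * (\<alpha>\<^sub>2 powr (- (- k)) * (1 - \<beta>\<^sub>1\<^sup>2 / \<alpha>\<^sub>1\<^sup>2) powr (m + 1 / 2) * (1 - \<beta>\<^sub>2\<^sup>2 / \<alpha>\<^sub>2\<^sup>2) powr (n + 1 / 2)) /
        ((sqrt pi * sqrt pi) * \<alpha>\<^sub>1 powr k * ?G1 * ?G2) *
        (Gamma ((k + 1) / 2) * Gamma ((1 - k) / 2)) * ?G3 * ?G4 * ?H1 * ?H2"
      unfolding vg_abs_moment_def neg powr_minus[of \<alpha>\<^sub>2 "- k"] by (simp add: field_simps)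
    also have "2 powr k * 2 powr (- k) = (1 :: real)"
      by (simp flip: powr_add)
    also have "sqrt pi * sqrt pi = pi"
      by simp
    finally show ?thesis
      unfolding Gamma_reflection_half by (simp add: mult_ac)
  qed
  ultimately show ?thesis by simp
qed

end
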